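(* Let $H$ be an $r$-uniform hypergraph with $r\geq 3$, and let $H_{p,q}$ be any $(p,q)$-extension of $H$ (as defined in the context). Then $Spec_{(2,2)}(H_{p,q}) = Spec_{(2,2)}(H)$.
   Context: A hypergraph $H$ consists of a finite vertex set $V(H)$ and a family $E(H)$ of subsets of $V(H)$ (edges); it is $r$-uniform if every edge has exactly $r$ vertices. A $(2,2)$-colouring of $H$ is an assignment of colours to the vertices such that every edge contains vertices of exactly two distinct colours. A $k$-$(2,2)$-colouring is a $(2,2)$-colouring using exactly $k$ colours. The $(2,2)$-spectrum $Spec_{(2,2)}(H)$ is the set of all integers $k$ such that $H$ has a $k$-$(2,2)$-colouring. $(p,q)$-extension: Let $H$ be $r$-uniform, $r\ge 3$, and let $E^*=\{v_1,\dots,v_r\}$ be an edge of $H$. Let $W=\{w_1,\dots,w_p\}$ ($p\ge 1$) and $U=\{u_1,\dots,u_q\}$ ($q \ge 0$) be sets of new vertices, pairwise disjoint from each other and from $V(H)$. Let $T$ be a non-empty subset of $\{1,2,\dots,\min\{p,\lfloor (r-1)/2\rfloor\}\}$. If $q\ge 1$, let $P$ be a non-empty subset of $\{1,\dots,\min\{p,r-2\}\}$ and $Q$ a non-empty subset of $\{1,\dots,\min\{q,r-2\}\}$ such that there exist $x\in P$, $y\in Q$ with $x+y\le r-1$. The $(p,q)$-extension $H_{p,q}$ has vertex set $V(H)\cup W\cup U$ and edge set consisting of all edges of $H$ together with: (Type 1) every $r$-set $K\subseteq E^*\cup W$ with $|K\cap W|\in T$; (Type 2, only when $q\ge 1$)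 every $r$-set $K\subseteq E^*\cup W\cup U$ with $|K\cap W|\in P$, $|K\cap U|\in Q$ and $|K\cap W|+|K\cap U|\le r-1$ (so the remaining $r-|K\cap W|-|K\cap U|$ vertices of $K$ lie in $E^*$). When $q=0$ there are no Type 2 edges. *)

theory Defs
  imports Main
begin

record 'a hypergraph =
  hverts :: "'a set"
  hedges :: "'a set set"

definition hypergraph :: "'a hypergraph \<Rightarrow> bool" where
  "hypergraph H \<longleftrightarrow> finite (hverts H) \<and> (\<forall>e\<in>hedges H. e \<subseteq> hverts H)"

definition uniform :: "nat \<Rightarrow> 'a hypergraph \<Rightarrow> bool" where
  "uniform r H \<longleftrightarrow> (\<forall>e\<in>hedges H. card e = r)"

text \<open>Colours are natural numbers; since vertex sets are finite this is no restriction.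
  Only the values of a colouring on the vertex set matter.\<close>

definition colouring22 :: "'a hypergraph \<Rightarrow> ('a \<Rightarrow> nat) \<Rightarrow> bool" where
  "colouring22 H c \<longleftrightarrow> (\<forall>e\<in>hedges H. card (c ` e) = 2)"

definition k_colouring22 :: "nat \<Rightarrow> 'a hypergraph \<Rightarrow> ('a \<Rightarrow> nat) \<Rightarrow> bool" where
  "k_colouring22 k H c \<longleftrightarrow> colouring22 H c \<and> card (c ` hverts H) = k"

definition spec22 :: "'a hypergraph \<Rightarrow> nat set" where
  "spec22 H = {k. \<exists>c. k_colouring22 k H c}"

definition type1_edges :: "nat \<Rightarrow> 'a set \<Rightarrow> 'a set \<Rightarrow> nat set \<Rightarrow> 'a set set" where
  "type1_edges r Es W T = {K. K \<subseteq> Es \<union> W \<and> card K = r \<and> card (K \<inter> W) \<in> T}"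

definition type2_edges ::
  "nat \<Rightarrow> 'a set \<Rightarrow> 'a set \<Rightarrow> 'a set \<Rightarrow> nat set \<Rightarrow> nat set \<Rightarrow> 'a set set" where
  "type2_edges r Es W U P Q =
    {K. K \<subseteq> Es \<union> W \<union> U \<and> card K = r \<and> card (K \<inter> W) \<in> P \<and> card (K \<inter> U) \<in> Q \<and>
        card (K \<inter> W) + card (K \<inter> U) \<le> r - 1}"

text \<open>\<open>pq_extension r p q H H'\<close>: \<open>H'\<close> is a \<open>(p,q)\<close>-extension of the \<open>r\<close>-uniform
  hypergraph \<open>H\<close>, for some choice of the edge \<open>Es\<close>, the new vertices \<open>W\<close>, \<open>U\<close> and the
  parameter sets \<open>T\<close>, \<open>P\<close>, \<open>Q\<close>. The sets \<open>P\<close>, \<open>Q\<close> are irrelevant when \<open>q = 0\<close>.\<close>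

definition pq_extension ::
  "nat \<Rightarrow> nat \<Rightarrow> nat \<Rightarrow> 'a hypergraph \<Rightarrow> 'a hypergraph \<Rightarrow> bool" where
  "pq_extension r p q H H' \<longleftrightarrow>
    (\<exists>Es W U T P Q.
       Es \<in> hedges H \<and>
       p \<ge> 1 \<and> finite W \<and> card W = p \<and>
       finite U \<and> card U = q \<and>
       W \<inter> U = {} \<and> W \<inter> hverts H = {} \<and> U \<inter> hverts H = {} \<and>
       T \<noteq> {} \<and> T \<subseteq> {1..min p ((r - 1) div 2)} \<and>
       (q \<ge> 1 \<longrightarrow>
          P \<noteq> {} \<and> P \<subseteq> {1..min p (r - 2)} \<and>
          Q \<noteq> {} \<and> Q \<subseteq> {1..min q (r - 2)} \<and>
          (\<exists>x\<in>P. \<exists>y\<in>Q. x + y \<le> r - 1)) \<and>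
       hverts H' = hverts H \<union> W \<union> U \<and>
       hedges H' = hedges H \<union> type1_edges r Es W T \<union>
         (if q \<ge> 1 then type2_edges r Es W U P Q else {}))"

end

theory Submission imports Defs begin

text \<open>Let \<open>E\<close> be the chosen edge. A new vertex with a colour missing on \<open>E\<close> lies in an edge that also
  meets both colours of \<open>E\<close>: for \<open>w \<in> W\<close> because a Type 1 edge keeps at least two vertices of \<open>E\<close>,
  and for \<open>u \<in> U\<close> because the \<open>W\<close>-vertices of a Type 2 edge already carry one colour of \<open>E\<close>, so that
  one vertex of \<open>E\<close> with the other colour suffices. Hence restricting a colouring of the extension to
  \<open>H\<close> loses no colours. Conversely, a colouring of \<open>H\<close> extends by giving \<open>W\<close> the colour occurring
  at most \<open>r/2\<close> times on \<open>E\<close> and \<open>U\<close> the other one; a Type 1 edge has more than \<open>r/2\<close> vertices in \<open>E\<close>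
  and so contains the majority colour as well.\<close>

lemma card_eq_2_no_three:
  assumes "card X = 2" "x \<in> X" "y \<in> X" "z \<in> X" "x \<noteq> y" "x \<noteq> z" "y \<noteq> z"
  shows False
proof -
  have "finite X" using assms(1) by (simp add: card_ge_0_finite)
  then have "card {x, y, z} \<le> card X" using assms by (intro card_mono) auto
  then show False using assms by simp
qed

text \<open>If \<open>c w\<close> were missing on \<open>Es\<close>, some Type 1 edge would carry
  three colours: \<open>1 \<le> t\<close> leaves room for \<open>w\<close> among its
  \<open>t\<close> vertices in \<open>W\<close>, and \<open>t + 2 \<le> r\<close> leaves room in
  \<open>Es\<close> for one vertex of each colour.\<close>

lemma type1_colour_mem:
  fixes c :: "'a \<Rightarrow> nat"
  assumes Es: "finite Es" "card Es = r" "card (c ` Es) = 2"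
    and W: "finite W" "W \<inter> Es = {}" "w \<in> W"
    and t: "t \<in> T" "1 \<le> t" "t \<le> card W" "t + 2 \<le> r"
    and col: "\<And>K. K \<in> type1_edges r Es W T \<Longrightarrow> card (c ` K) = 2"
  shows "c w \<in> c ` Es"
proof (rule ccontr)
  assume new: "c w \<notin> c ` Es"
  obtain a b where ab: "a \<in> Es" "b \<in> Es" "c a \<noteq> c b"
  proof -
    obtain i j where "c ` Es = {i, j}" "i \<noteq> j" using Es(3) by (auto simp: card_2_iff)
    then show thesis using that by (metis imageE insertI1 insertI2)
  qed
  have "card {w} \<le> t" "{w} \<subseteq> W" using t(2) W(3) by auto
  then obtain A where A: "{w} \<subseteq> A" "A \<subseteq> W" "card A = t"
    using exists_subset_between[OF _ t(3) _ W(1)] by metis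
  have "card {a, b} \<le> r - t" "r - t \<le> card Es" "{a, b} \<subseteq> Es"
    using t(4) Es(2) ab by (auto simp: card_insert_if)
  then obtain B where B: "{a, b} \<subseteq> B" "B \<subseteq> Es" "card B = r - t"
    using exists_subset_between[OF _ _ _ Es(1)] by metis
  have "finite A" "finite B" "A \<inter> B = {}"
    using A B W Es by (auto intro: finite_subset)
  then have "card (A \<union> B) = r" using A B t by (simp add: card_Un_disjoint)
  moreover have "(A \<union> B) \<inter> W = A" using A B W by auto
  ultimately have "A \<union> B \<in> type1_edges r Es W T"
    using A B t by (auto simp: type1_edges_def)
  from col[OF this] show False
    by (rule card_eq_2_no_three[of _ "c w" "c a" "c b"]) (use A B ab new in auto)
qed

text \<open>Here \<open>x + y + 1 \<le> r\<close> guarantees only one vertex in \<open>Es\<close>.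
  This is enough because the assumption on \<open>W\<close>, supplied by
  \<open>type1_colour_mem\<close>, already puts one colour of \<open>Es\<close> on the edge.\<close>

lemma type2_colour_mem:
  fixes c :: "'a \<Rightarrow> nat"
  assumes Es: "finite Es" "card Es = r" "card (c ` Es) = 2"
    and W: "finite W" "W \<inter> Es = {}" "\<And>w. w \<in> W \<Longrightarrow> c w \<in> c ` Es"
    and U: "finite U" "U \<inter> Es = {}" "W \<inter> U = {}" "u \<in> U"
    and xy: "x \<in> P" "1 \<le> x" "x \<le> card W" "y \<in> Q" "1 \<le> y" "y \<le> card U" "x + y + 1 \<le> r"
    and col: "\<And>K. K \<in> type2_edges r Es W U P Q \<Longrightarrow> card (c ` K) = 2"
  shows "c u \<in> c ` Es"
proof (rule ccontr)
  assume new: "c u \<notin> c ` Es"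
  obtain A where A: "A \<subseteq> W" "card A = x"
    using obtain_subset_with_card_n[OF xy(3)] by blast
  then obtain w where w: "w \<in> A" using xy by fastforce
  then have cw: "c w \<in> c ` Es" using A W by blast
  \<comment> \<open>The vertex \<open>a\<close> depends on \<open>w\<close>: it supplies the colour
    of \<open>Es\<close> that \<open>w\<close> does not have.\<close>
  obtain a where a: "a \<in> Es" "c a \<noteq> c w"
    using Es(3) by (metis card_2_iff image_iff insertCI)
  have "card {u} \<le> y" "{u} \<subseteq> U" using xy(5) U(4) by auto
  then obtain B where B: "{u} \<subseteq> B" "B \<subseteq> U" "card B = y"
    using exists_subset_between[OF _ xy(6) _ U(1)] by metis
  have "card {a} \<le> r - (x + y)" "r - (x + y) \<le> card Es" "{a} \<subseteq> Es"
    using xy(7) Es(2) a(1) by auto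
  then obtain D where D: "{a} \<subseteq> D" "D \<subseteq> Es" "card D = r - (x + y)"
    using exists_subset_between[OF _ _ _ Es(1)] by metis
  have fin: "finite A" "finite B" "finite D"
    using A B D W U Es by (auto intro: finite_subset)
  have "A \<inter> B = {}" "(A \<union> B) \<inter> D = {}"
    using A B D W U by auto
  then have "card (A \<union> B \<union> D) = r" using A B D xy fin by (simp add: card_Un_disjoint)
  moreover have "(A \<union> B \<union> D) \<inter> W = A" "(A \<union> B \<union> D) \<inter> U = B" using A B D W U by auto
  ultimately have "A \<union> B \<union> D \<in> type2_edges r Es W U P Q"
    using A B D xy by (auto simp: type2_edges_def)
  from col[OF this] show False
    by (rule card_eq_2_no_three[of _ "c u" "c w" "c a"]) (use A B D a w cw new in auto)
qed

text \<open>The two colour classes partition \<open>E\<close>, so one of them has at most half of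
  the vertices; its colour is named \<open>b\<close>.\<close>

lemma obtain_minority_colour:
  fixes c :: "'a \<Rightarrow> nat"
  assumes "finite E" "card (c ` E) = 2"
  obtains a b where "c ` E = {a, b}" "a \<noteq> b" "2 * card {v \<in> E. c v = b} \<le> card E"
proof -
  obtain a b where ab: "c ` E = {a, b}" "a \<noteq> b" using assms(2) by (auto simp: card_2_iff)
  have "E = {v \<in> E. c v = a} \<union> {v \<in> E. c v = b}" using ab(1) by blast
  then have "card E = card {v \<in> E. c v = a} + card {v \<in> E. c v = b}"
    using assms(1) ab(2) card_Un_disjoint[of "{v \<in> E. c v = a}" "{v \<in> E. c v = b}"] by fastforce
  then consider "2 * card {v \<in> E. c v = b} \<le> card E" | "2 * card {v \<in> E. c v = a} \<le> card E"
    by linarith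
  then show thesis by cases (use that ab in \<open>auto simp: insert_commute\<close>)
qed

text \<open>Since \<open>W\<close> brings in only \<open>b\<close>, the one danger is that
  \<open>K\<close> is monochromatic in \<open>b\<close>. Its part in \<open>Es\<close> is too large
  for that.\<close>

lemma two_colours_type1:
  fixes c :: "'a \<Rightarrow> nat"
  assumes Es: "finite Es" "card Es = r" "c ` Es = {a, b}" "a \<noteq> b"
    and minority: "2 * card {v \<in> Es. c v = b} \<le> r"
    and W: "finite W" "W \<inter> Es = {}" "\<And>w. w \<in> W \<Longrightarrow> c w = b"
    and T: "\<And>t. t \<in> T \<Longrightarrow> 1 \<le> t \<and> 2 * t < r"
    and K: "K \<in> type1_edges r Es W T"
  shows "card (c ` K) = 2"
proof -
  have K': "K \<subseteq> Es \<union> W" "card K = r" "card (K \<inter> W) \<in> T"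
    using K by (auto simp: type1_edges_def)
  have fin: "finite K" using K'(1) Es(1) W(1) by (auto intro: finite_subset)
  have "K \<inter> W \<noteq> {}" using T[OF K'(3)] by force
  then obtain w where "w \<in> K \<inter> W" by blast
  then have b: "b \<in> c ` K" using W(3) by force
  have "K = (K \<inter> W) \<union> (K \<inter> Es)" "(K \<inter> W) \<inter> (K \<inter> Es) = {}" using K'(1) W(2) by auto
  then have "card K = card (K \<inter> W) + card (K \<inter> Es)"
    using fin by (metis card_Un_disjoint finite_Int)
  \<comment> \<open>The strict bound \<open>2 * t < r\<close> compensates for the possible tie in
    \<open>minority\<close>: more than half of \<open>K\<close> lies in \<open>Es\<close>.\<close>
  then have "\<not> card (K \<inter> Es) \<le> card {v \<in> Es. c v = b}"
    using T[OF K'(3)] K'(2) minority by linarith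
  then have "\<not> K \<inter> Es \<subseteq> {v \<in> Es. c v = b}"
    using card_mono[of "{v \<in> Es. c v = b}" "K \<inter> Es"] Es(1) by auto
  then obtain v where v: "v \<in> K" "v \<in> Es" "c v \<noteq> b" by blast
  then have "c v = a" using Es(3) by (metis imageI insertE singletonD)
  then have "a \<in> c ` K" using v(1) by (metis imageI)
  moreover have "c ` K \<subseteq> c ` Es \<union> c ` W" using K'(1) by blast
  then have "c ` K \<subseteq> {a, b}" using Es(3) W(3) by auto
  ultimately have "c ` K = {a, b}" using b by blast
  then show ?thesis using Es(4) by simp
qed

lemma two_colours_type2:
  fixes c :: "'a \<Rightarrow> nat"
  assumes "c ` Es = {a, b}" "a \<noteq> b"
    and W: "\<And>w. w \<in> W \<Longrightarrow> c w = b" and U: "\<And>u. u \<in> U \<Longrightarrow> c u = a"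
    and PQ: "0 \<notin> P" "0 \<notin> Q"
    and K: "K \<in> type2_edges r Es W U P Q"
  shows "card (c ` K) = 2"
proof -
  have K': "K \<subseteq> Es \<union> W \<union> U" "card (K \<inter> W) \<noteq> 0" "card (K \<inter> U) \<noteq> 0"
    using K PQ unfolding type2_edges_def by (metis (mono_tags, lifting) mem_Collect_eq)+
  have "K \<inter> W \<noteq> {}" "K \<inter> U \<noteq> {}" using K'(2,3) by force+
  then obtain w u where "w \<in> K \<inter> W" "u \<in> K \<inter> U" by blast
  then have "b \<in> c ` K" "a \<in> c ` K" using W U by force+
  moreover have "c ` K \<subseteq> {a, b}" using K'(1) assms(1) W U by blast
  ultimately have "c ` K = {a, b}" by blast
  then show ?thesis using assms(2) by simp
qed

theorem theorem2p2:
  fixes H H' :: "'a hypergraph" and r p q :: nat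
  assumes "hypergraph H" and "uniform r H" and "r \<ge> 3"
    and "pq_extension r p q H H'"
  shows "spec22 H' = spec22 H"
proof -
  obtain Es W U T P Q where Es: "Es \<in> hedges H"
    and W: "finite W" "card W = p" and U: "finite U" "card U = q"
    and disj: "W \<inter> U = {}" "W \<inter> hverts H = {}" "U \<inter> hverts H = {}"
    and T: "T \<noteq> {}" "T \<subseteq> {1..min p ((r - 1) div 2)}"
    and PQ: "q \<ge> 1 \<longrightarrow> P \<noteq> {} \<and> P \<subseteq> {1..min p (r - 2)} \<and>
          Q \<noteq> {} \<and> Q \<subseteq> {1..min q (r - 2)} \<and>
          (\<exists>x\<in>P. \<exists>y\<in>Q. x + y \<le> r - 1)"
    and V': "hverts H' = hverts H \<union> W \<union> U"
    and E': "hedges H' = hedges H \<union> type1_edges r Es W T \<union>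
         (if q \<ge> 1 then type2_edges r Es W U P Q else {})"
    using assms(4) unfolding pq_extension_def by (elim exE conjE) (rule that; assumption)
  have sub: "e \<subseteq> hverts H" if "e \<in> hedges H" for e
    using assms(1) that by (auto simp: hypergraph_def)
  have finEs: "finite Es"
    using assms(1) sub[OF Es] by (auto simp: hypergraph_def intro: finite_subset)
  have cardEs: "card Es = r" using assms(2) Es by (auto simp: uniform_def)
  have disjEs: "W \<inter> Es = {}" "U \<inter> Es = {}" using disj sub[OF Es] by auto
  have T_bounds: "1 \<le> t \<and> t \<le> card W \<and> 2 * t < r \<and> t + 2 \<le> r" if "t \<in> T" for t
  proof -
    have "1 \<le> t" "t \<le> p" "t \<le> (r - 1) div 2" using that T(2) by auto
    \<comment> \<open>The bound \<open>t + 2 \<le> r\<close> follows from \<open>2 * t < r\<close>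
      and \<open>r \<ge> 3\<close>, with equality possible at \<open>r = 3\<close>.\<close>
    then show ?thesis using W(2) assms(3) by linarith
  qed
  have "k \<in> spec22 H" if k: "k \<in> spec22 H'" for k
  proof -
    obtain c :: "'a \<Rightarrow> nat" where c: "\<And>e. e \<in> hedges H' \<Longrightarrow> card (c ` e) = 2" "card (c ` hverts H') = k"
      using k by (auto simp: spec22_def k_colouring22_def colouring22_def)
    have c2: "card (c ` Es) = 2" using c(1) E' Es by auto
    obtain t where "t \<in> T" using T(1) by auto
    then have cW: "c w \<in> c ` Es" if "w \<in> W" for w
      using type1_colour_mem[OF finEs cardEs c2 W(1) disjEs(1) that, of t T] T_bounds c(1) E'
      by auto
    have cU: "c u \<in> c ` Es" if u: "u \<in> U" for u
    proof -
      have q: "q \<ge> 1" using u U by (metis One_nat_def Suc_leI card_gt_0_iff empty_iff)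
      then obtain x y where xy: "x \<in> P" "y \<in> Q" "x + y \<le> r - 1" using PQ by blast
      moreover have "1 \<le> x" "x \<le> card W" "1 \<le> y" "y \<le> card U" using xy PQ q W U by auto
      moreover have "card (c ` K) = 2" if "K \<in> type2_edges r Es W U P Q" for K
        using c(1) E' q that by auto
      \<comment> \<open>As \<open>r \<ge> 3\<close>, the truncated \<open>x + y \<le> r - 1\<close>
        amounts to \<open>x + y + 1 \<le> r\<close>.\<close>
      ultimately show ?thesis
        using type2_colour_mem[OF finEs cardEs c2 W(1) disjEs(1) cW U(1) disjEs(2) disj(1) u,
            of x P y Q] assms(3) by auto
    qed
    have "c ` hverts H' = c ` hverts H" using cW cU V' sub[OF Es] by blast
    then have "k_colouring22 k H c"
      using c E' by (simp add: k_colouring22_def colouring22_def)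
    then show ?thesis by (auto simp: spec22_def)
  qed
  moreover have "k \<in> spec22 H'" if k: "k \<in> spec22 H" for k
  proof -
    obtain c :: "'a \<Rightarrow> nat" where c: "\<And>e. e \<in> hedges H \<Longrightarrow> card (c ` e) = 2" "card (c ` hverts H) = k"
      using k by (auto simp: spec22_def k_colouring22_def colouring22_def)
    obtain a b where ab: "c ` Es = {a, b}" "a \<noteq> b" "2 * card {v \<in> Es. c v = b} \<le> card Es"
      using obtain_minority_colour[OF finEs c(1)[OF Es]] .
    \<comment> \<open>The minority colour \<open>b\<close> must go to \<open>W\<close>, so that Type
      1 edges still reach a vertex of colour \<open>a\<close> in \<open>Es\<close>.\<close>
    define c' where "c' v = (if v \<in> W then b else if v \<in> U then a else c v)" for v
    have old: "c' v = c v" if "v \<in> hverts H" for v using disj that by (auto simp: c'_def)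
    have oldI: "c' ` X = c ` X" if "X \<subseteq> hverts H" for X using old that by (intro image_cong) auto
    have c'Es: "c' ` Es = {a, b}" using oldI[OF sub[OF Es]] ab(1) by simp
    have c'W: "c' w = b" if "w \<in> W" for w using that by (simp add: c'_def)
    have c'U: "c' u = a" if "u \<in> U" for u using that disj by (auto simp: c'_def)
    have "{v \<in> Es. c' v = b} = {v \<in> Es. c v = b}" using old sub[OF Es] by auto
    then have minority: "2 * card {v \<in> Es. c' v = b} \<le> r" using ab(3) cardEs by simp
    have "card (c' ` e) = 2" if e: "e \<in> hedges H'" for e
    proof -
      consider "e \<in> hedges H" | "e \<in> type1_edges r Es W T"
        | "q \<ge> 1" "e \<in> type2_edges r Es W U P Q"
        using e E' by (auto split: if_splits)
      then show ?thesis
      proof cases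
        case 1
        then show ?thesis using oldI sub c(1) by simp
      next
        case 2
        then show ?thesis
          using two_colours_type1[OF finEs cardEs c'Es ab(2) minority W(1) disjEs(1) c'W]
            T_bounds by blast
      next
        case 3
        have "0 \<notin> P" "0 \<notin> Q" using PQ 3(1) by auto
        then show ?thesis using two_colours_type2[OF c'Es ab(2) c'W c'U _ _ 3(2)] by blast
      qed
    qed
    moreover have "c' ` hverts H' = c' ` hverts H"
    proof -
      \<comment> \<open>Both colours on the new vertices already occur on \<open>Es\<close>, so the
        number of colours stays \<open>k\<close>.\<close>
      have "c' ` W \<subseteq> c' ` Es" "c' ` U \<subseteq> c' ` Es" using c'W c'U c'Es by auto
      then show ?thesis using V' sub[OF Es] by blast
    qed
    ultimately have "k_colouring22 k H' c'"
      using c(2) oldI[of "hverts H"] by (simp add: k_colouring22_def colouring22_def)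
    then show ?thesis by (auto simp: spec22_def)
  qed
  ultimately show ?thesis by blast
qed

end
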